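(* Let $k \ge 1$ and $\theta = 2\pi/(4k+4)$. For every $\varepsilon > 0$ there exist a finite point set $P$ in general position and $u, w \in P$ such that the shortest path between $u$ and $w$ in the $\theta_{4k+4}$-graph on $P$ has length at least $(1 + 2\tan(\theta/2) + 2\tan^2(\theta/2) - \varepsilon)|uw|$. That is, the worst-case spanning ratio of $\theta_{4k+4}$-graphs is at least $1 + 2\tan(\theta/2) + 2\tan^2(\theta/2)$.
   Context: Cones: for $m \ge 2$, $\theta = 2\pi/m$; around each point $u$ draw $m$ rays with consecutive angular separation $\theta$, oriented so the vertical upward ray from $u$ bisects a cone $C_0^u$; cones numbered clockwise, same orientation at every point. General position: no two points on a line parallel to a cone boundary ray, no two on a line perpendicular to a cone bisector, no three collinear. The $\theta_m$-graph on $P$: for each $u\in P$ and each cone $C_i^u$ containing another point of $P$, add an edge from $u$ to the point of $C_i^u$ whose orthogonal projection onto the bisector of $C_i^u$ is closest to $u$; edges weighted by Euclidean length. *)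

theory Defs
  imports "HOL-Analysis.Analysis"
begin

text \<open>Points of the plane are pairs (x, y); the Euclidean distance is the library's dist.
  A direction given by an angle phi measured clockwise from the upward vertical is
  (sin phi, cos phi).\<close>

definition dir :: "real \<Rightarrow> real \<times> real" where
  "dir phi = (sin phi, cos phi)"

definition cone_angle :: "nat \<Rightarrow> real" where
  "cone_angle m = 2 * pi / real m"

text \<open>Cone C_i^u (i < m): cone i is bisected by the ray in direction dir (i * theta);
  cone 0 is bisected by the upward vertical ray, cones numbered clockwise.
  Boundary convention: half-open (irrelevant under general position).\<close>

definition in_cone :: "nat \<Rightarrow> nat \<Rightarrow> real \<times> real \<Rightarrow> real \<times> real \<Rightarrow> bool" where
  "in_cone m i u v \<longleftrightarrow> v \<noteq> u \<and>
     (\<exists>r \<alpha>. r > 0 \<and> - cone_angle m / 2 \<le> \<alpha> \<and> \<alpha> < cone_angle m / 2 \<and>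
        v - u = r *\<^sub>R dir (real i * cone_angle m + \<alpha>))"

definition bis_proj :: "nat \<Rightarrow> nat \<Rightarrow> real \<times> real \<Rightarrow> real \<times> real \<Rightarrow> real" where
  "bis_proj m i u v = (v - u) \<bullet> dir (real i * cone_angle m)"

definition general_position :: "nat \<Rightarrow> (real \<times> real) set \<Rightarrow> bool" where
  "general_position m P \<longleftrightarrow>
     (\<forall>p\<in>P. \<forall>q\<in>P. p \<noteq> q \<longrightarrow> (\<forall>i<m.
        \<comment> \<open>not parallel to a cone boundary ray (direction i*theta - theta/2)\<close>
        (let d = dir (real i * cone_angle m - cone_angle m / 2)
         in fst (p - q) * snd d - snd (p - q) * fst d \<noteq> 0) \<and>
        \<comment> \<open>not perpendicular to a cone bisector\<close>
        (p - q) \<bullet> dir (real i * cone_angle m) \<noteq> 0)) \<and>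
     (\<forall>p\<in>P. \<forall>q\<in>P. \<forall>r\<in>P. p \<noteq> q \<and> q \<noteq> r \<and> p \<noteq> r \<longrightarrow> \<not> collinear {p, q, r})"

definition theta_edge :: "nat \<Rightarrow> (real \<times> real) set \<Rightarrow> real \<times> real \<Rightarrow> real \<times> real \<Rightarrow> bool" where
  "theta_edge m P u v \<longleftrightarrow> u \<in> P \<and> v \<in> P \<and>
     (\<exists>i<m. in_cone m i u v \<and>
        (\<forall>w\<in>P. in_cone m i u w \<longrightarrow> bis_proj m i u v \<le> bis_proj m i u w))"

definition theta_path ::
  "nat \<Rightarrow> (real \<times> real) set \<Rightarrow> (real \<times> real) list \<Rightarrow> real \<times> real \<Rightarrow> real \<times> real \<Rightarrow> bool" where
  "theta_path m P ps u w \<longleftrightarrow> ps \<noteq> [] \<and> hd ps = u \<and> last ps = w \<and> set ps \<subseteq> P \<and>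
     (\<forall>j < length ps - 1. theta_edge m P (ps ! j) (ps ! Suc j) \<or> theta_edge m P (ps ! Suc j) (ps ! j))"

definition path_length :: "(real \<times> real) list \<Rightarrow> real" where
  "path_length ps = (\<Sum>j < length ps - 1. dist (ps ! j) (ps ! Suc j))"

end

theory Submission
  imports Defs
begin

text \<open>
  Write t for the tangent of half the cone angle. Since m is a multiple of 4, four of the cones are
  centred on the axes, so edges can be blocked vertically and horizontally. Put u at the origin
  and w at (t, 1), on the boundary of the upward cone of u. The left corner A = (-t, 1) of the
  triangle spanned by u and w blocks the edge uw, V = (t, 1 + 2t^2) blocks the edge from A to w,
  and X, on the line uw halfway up between w and V, blocks the edge Vw without lying in another
  cone of u. The path u A V X w has exactly the required ratio. The mirror image B of V blocks the
  edge from w to A, the mirror image Y of X blocks the edge BA, and the central reflection of all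
  these points (which swaps u and w) blocks the edge from w to u in the same way.

  Path lengths are bounded below by a potential that changes by at most the length of each edge.
  The limit configuration is degenerate, so it is first moved linearly to satisfy finitely many
  strict inequalities, and then moved to general position by avoiding finitely many lines.
\<close>

section \<open>Directions and cone membership in rotated coordinates\<close>

lemma dir_add: "dir (\<phi> + \<alpha>) = cos \<alpha> *\<^sub>R dir \<phi> + sin \<alpha> *\<^sub>R dir (\<phi> + pi/2)"
  by (simp add: dir_def sin_add cos_add algebra_simps)

lemma dir_inner_dir: "dir a \<bullet> dir b = cos (a - b)"
  by (simp add: dir_def cos_diff algebra_simps)

lemma dir_decompose: "v = (v \<bullet> dir \<phi>) *\<^sub>R dir \<phi> + (v \<bullet> dir (\<phi> + pi/2)) *\<^sub>R dir (\<phi> + pi/2)"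
proof -
  have sc: "sin \<phi> * sin \<phi> = 1 - cos \<phi> * cos \<phi>"
    using sin_cos_squared_add[of \<phi>] by (simp add: power2_eq_square)
  obtain x y where v: "v = (x, y)" by (cases v)
  have 1: "x = (x * sin \<phi> + y * cos \<phi>) * sin \<phi> + (x * cos \<phi> - y * sin \<phi>) * cos \<phi>"
    using sc by algebra
  have 2: "y = (x * sin \<phi> + y * cos \<phi>) * cos \<phi> - (x * cos \<phi> - y * sin \<phi>) * sin \<phi>"
    using sc by algebra
  show ?thesis
    using 1 2 by (simp add: v dir_def sin_add cos_add)
qed

lemma dir_eq_iff: "dir a = dir b \<longleftrightarrow> (\<exists>n::int. a = b + 2 * pi * n)"
  unfolding dir_def by (auto simp: sin_cos_eq_iff)

lemma norm_dir [simp]: "norm (dir a) = 1"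
  by (simp add: dir_def norm_Pair)

text \<open>Companion of \<open>bis_proj\<close>: the signed offset from the bisector, positive on
  the clockwise side. Both together are orthonormal coordinates.\<close>

definition perp_proj :: "nat \<Rightarrow> nat \<Rightarrow> real \<times> real \<Rightarrow> real \<times> real \<Rightarrow> real" where
  "perp_proj m i u v = (v - u) \<bullet> dir (real i * cone_angle m + pi/2)"

lemma cone_angle_half_bounds:
  assumes "m \<ge> 8"
  shows "0 < cone_angle m / 2" "cone_angle m / 2 \<le> pi/8"
proof -
  have "pi / real m \<le> pi / 8" using assms by (intro divide_left_mono) auto
  then show "0 < cone_angle m / 2" "cone_angle m / 2 \<le> pi/8"
    using assms by (auto simp: cone_angle_def)
qed

text \<open>In the frame of the bisector a cone is a slope condition. It is strict here and weak in
  \<open>in_coneD\<close>, so the half-open boundary never has to be examined later.\<close>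

lemma in_coneI:
  assumes m: "m \<ge> 8"
    and b: "\<bar>perp_proj m i u v\<bar> < tan (cone_angle m / 2) * bis_proj m i u v"
  shows "in_cone m i u v"
proof -
  define a where "a = bis_proj m i u v"
  define b where "b = perp_proj m i u v"
  define h where "h = cone_angle m / 2"
  have h: "0 < h" "h < pi/2"
    using cone_angle_half_bounds[OF m] pi_gt_zero unfolding h_def by linarith+
  have t: "tan h > 0" using h by (simp add: tan_gt_zero)
  have ba: "\<bar>b\<bar> < tan h * a" using b by (simp add: a_def b_def h_def)
  then have a: "a > 0" using t by (meson abs_ge_zero le_less_trans zero_less_mult_pos)
  have q: "\<bar>b/a\<bar> < tan h" using ba a by (simp add: divide_simps)
  then have q': "- tan h < b/a" "b/a < tan h" by linarith+
  \<comment> \<open>The witnesses are the polar coordinates relative to the bisector: angle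
    \<open>arctan (b/a)\<close> and radius \<open>a / cos \<alpha>\<close>.\<close>
  define \<alpha> where "\<alpha> = arctan (b/a)"
  have at: "arctan (tan h) = h" using h by (simp add: arctan_tan)
  have al: "- h < \<alpha>" "\<alpha> < h"
    using arctan_less_iff[of "b/a" "tan h"] arctan_less_iff[of "- tan h" "b/a"] q'
    by (simp_all add: \<alpha>_def at arctan_minus del: arctan_less_iff)
  have c: "cos \<alpha> > 0" unfolding \<alpha>_def using cos_gt_zero_pi arctan_lbound arctan_ubound by blast
  have ts: "sin \<alpha> / cos \<alpha> = b/a" using tan_arctan[of "b/a"] by (simp add: \<alpha>_def tan_def)
  define r where "r = a / cos \<alpha>"
  have r: "r > 0" using a c by (simp add: r_def)
  have "r * cos \<alpha> = a" using c by (simp add: r_def)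
  moreover have "r * sin \<alpha> = b" using ts a by (simp add: r_def field_simps)
  moreover have "v - u = a *\<^sub>R dir (real i * cone_angle m) + b *\<^sub>R dir (real i * cone_angle m + pi/2)"
    unfolding a_def b_def bis_proj_def perp_proj_def by (rule dir_decompose)
  ultimately have eq: "v - u = r *\<^sub>R dir (real i * cone_angle m + \<alpha>)"
    by (simp add: dir_add[of "real i * cone_angle m" \<alpha>] scaleR_add_right)
  then have "v \<noteq> u" using r by (metis norm_dir norm_scaleR norm_zero right_minus_eq mult_1_right abs_of_pos less_irrefl)
  then show ?thesis
    unfolding in_cone_def using r eq al
    by (intro conjI exI[of _ r] exI[of _ \<alpha>]) (auto simp: h_def)
qed

lemma in_coneD:
  assumes m: "m \<ge> 8" and "in_cone m i u v"
  shows "\<bar>perp_proj m i u v\<bar> \<le> tan (cone_angle m / 2) * bis_proj m i u v" "bis_proj m i u v > 0"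
proof -
  define h where "h = cone_angle m / 2"
  have h: "0 < h" "h < pi/2"
    using cone_angle_half_bounds[OF m] pi_gt_zero unfolding h_def by linarith+
  obtain r \<alpha> where r: "r > 0" and al: "- h \<le> \<alpha>" "\<alpha> < h"
    and eq: "v - u = r *\<^sub>R dir (real i * cone_angle m + \<alpha>)"
    using assms(2) unfolding in_cone_def h_def by auto
  have a: "bis_proj m i u v = r * cos \<alpha>"
    by (simp add: bis_proj_def eq dir_inner_dir)
  have b: "perp_proj m i u v = r * sin \<alpha>"
    by (simp add: perp_proj_def eq dir_inner_dir cos_diff)
  have c: "cos \<alpha> > 0" using al h by (intro cos_gt_zero_pi) linarith+
  show "bis_proj m i u v > 0" using a r c by simp
  have "tan \<alpha> \<le> tan h" "tan (- h) \<le> tan \<alpha>"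
    by (rule tan_mono_le; use al h in linarith)+
  then have "\<bar>tan \<alpha>\<bar> \<le> tan h" by (simp add: abs_le_iff)
  moreover have "sin \<alpha> = tan \<alpha> * cos \<alpha>" using c by (simp add: tan_def)
  ultimately have "\<bar>sin \<alpha>\<bar> \<le> tan h * cos \<alpha>" using c by (simp add: abs_mult)
  then show "\<bar>perp_proj m i u v\<bar> \<le> tan (cone_angle m / 2) * bis_proj m i u v"
    using r by (simp add: a b abs_mult h_def mult.left_commute mult_left_mono)
qed

text \<open>Two polar angles of one vector differ by a multiple of 2 pi, which is \<open>m\<close>
  cone angles. The offsets lie in a half-open interval of length one cone angle, so the indices
  agree modulo \<open>m\<close>.\<close>

lemma in_cone_unique:
  assumes m: "m > 0" and ij: "i < m" "j < m" and "in_cone m i u v" "in_cone m j u v"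
  shows "i = j"
proof -
  define \<theta> where "\<theta> = cone_angle m"
  have th: "\<theta> > 0" "2 * pi = real m * \<theta>" using m by (auto simp: \<theta>_def cone_angle_def)
  obtain r \<alpha> where r: "r > 0" and al: "- \<theta>/2 \<le> \<alpha>" "\<alpha> < \<theta>/2"
    and eq: "v - u = r *\<^sub>R dir (real i * \<theta> + \<alpha>)"
    using assms(4) unfolding in_cone_def \<theta>_def by auto
  obtain s \<beta> where s: "s > 0" and be: "- \<theta>/2 \<le> \<beta>" "\<beta> < \<theta>/2"
    and eq': "v - u = s *\<^sub>R dir (real j * \<theta> + \<beta>)"
    using assms(5) unfolding in_cone_def \<theta>_def by auto
  have "norm (v - u) = r" "norm (v - u) = s" using r s
    by (metis eq norm_scaleR norm_dir mult_1_right abs_of_pos)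
       (metis s eq' norm_scaleR norm_dir mult_1_right abs_of_pos)
  then have "dir (real i * \<theta> + \<alpha>) = dir (real j * \<theta> + \<beta>)"
    using eq eq' r by auto
  then obtain n :: int where n: "real i * \<theta> + \<alpha> = real j * \<theta> + \<beta> + 2 * pi * n"
    using dir_eq_iff by blast
  define d :: int where "d = int i - int j - int m * n"
  have "of_int d * \<theta> = \<beta> - \<alpha>"
    using n unfolding th(2) d_def by (simp add: algebra_simps)
  then have "\<bar>of_int d * \<theta>\<bar> < \<theta>" using al be by linarith
  then have "\<bar>of_int d :: real\<bar> < 1" using th by (simp add: abs_mult)
  then have "d = 0" by linarith
  then have "int i - int j = int m * n" by (simp add: d_def)
  moreover have "\<bar>int i - int j\<bar> < int m" using ij by linarith
  ultimately have "\<bar>int m * n\<bar> < int m" by simp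
  then have "n = 0" using m by (simp add: abs_mult)
  then show ?thesis using \<open>int i - int j = int m * n\<close> by simp
qed

text \<open>By uniqueness of the cone, only cone \<open>i\<close> could witness an edge from
  \<open>p\<close> to \<open>q\<close>, and there \<open>r\<close> has a smaller projection.\<close>

lemma not_theta_edgeI:
  assumes m: "m \<ge> 8" and i: "i < m" and r: "r \<in> P"
    and q: "in_cone m i p q" and "in_cone m i p r"
    and "bis_proj m i p r < bis_proj m i p q"
  shows "\<not> theta_edge m P p q"
proof
  assume "theta_edge m P p q"
  then obtain j where j: "j < m" "in_cone m j p q"
    "\<forall>w\<in>P. in_cone m j p w \<longrightarrow> bis_proj m j p q \<le> bis_proj m j p w"
    unfolding theta_edge_def by auto
  have "i = j" using in_cone_unique[OF _ i j(1) q j(2)] m by auto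
  then show False using j r assms(5,6) by force
qed

section \<open>Cones along the axes and blocked edges\<close>

text \<open>With \<open>t\<close> the tangent of the half angle this is the open upward cone of
  \<open>p\<close>, and \<open>rightof\<close> is the open rightward one. Exchanging the points
  gives the downward and leftward cones.\<close>

definition upof :: "real \<Rightarrow> real \<times> real \<Rightarrow> real \<times> real \<Rightarrow> bool" where
  "upof t p q \<longleftrightarrow> \<bar>fst q - fst p\<bar> < t * (snd q - snd p)"

definition rightof :: "real \<Rightarrow> real \<times> real \<Rightarrow> real \<times> real \<Rightarrow> bool" where
  "rightof t p q \<longleftrightarrow> \<bar>snd q - snd p\<bar> < t * (fst q - fst p)"

lemma cone_axis_angles:
  assumes "m > 0"
  shows "4 dvd m \<Longrightarrow> real (m div 4) * cone_angle m = pi/2"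
    "4 dvd m \<Longrightarrow> real (m div 2) * cone_angle m = pi"
    "4 dvd m \<Longrightarrow> real (3 * (m div 4)) * cone_angle m = 3/2 * pi"
  using assms by (auto simp: cone_angle_def elim!: dvdE)

lemma projections_axis:
  assumes "m > 0" "4 dvd m"
  shows "bis_proj m 0 p q = snd q - snd p" "perp_proj m 0 p q = fst q - fst p"
    "bis_proj m (m div 4) p q = fst q - fst p" "perp_proj m (m div 4) p q = snd p - snd q"
    "bis_proj m (m div 2) p q = snd p - snd q" "perp_proj m (m div 2) p q = fst p - fst q"
    "bis_proj m (3 * (m div 4)) p q = fst p - fst q" "perp_proj m (3 * (m div 4)) p q = snd q - snd p"
proof -
  have s: "sin (3/2 * pi + pi / 2) = 0" "cos (3/2 * pi + pi / 2) = 1"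
    unfolding sin_add cos_add sin_3over2_pi cos_3over2_pi by simp_all
  note c = cone_axis_angles[OF assms]
  show "bis_proj m 0 p q = snd q - snd p" "perp_proj m 0 p q = fst q - fst p"
    "bis_proj m (m div 4) p q = fst q - fst p" "perp_proj m (m div 4) p q = snd p - snd q"
    "bis_proj m (m div 2) p q = snd p - snd q" "perp_proj m (m div 2) p q = fst p - fst q"
    "bis_proj m (3 * (m div 4)) p q = fst p - fst q" "perp_proj m (3 * (m div 4)) p q = snd q - snd p"
    unfolding bis_proj_def perp_proj_def c
    by (cases p; cases q; simp add: dir_def s sin_3over2_pi cos_3over2_pi del: times_divide_eq_left)+
qed

lemma upof_trans: "upof t p q \<Longrightarrow> upof t q r \<Longrightarrow> upof t p r"
  unfolding upof_def by (simp add: algebra_simps)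

lemma upof_snd: "t > 0 \<Longrightarrow> upof t p q \<Longrightarrow> snd p < snd q"
  unfolding upof_def by (smt (verit, best) zero_less_mult_pos)

locale quadrant_cones =
  fixes m :: nat and t :: real
  assumes m8: "m \<ge> 8" and m4: "4 dvd m"
  defines "t \<equiv> tan (cone_angle m / 2)"
begin

lemma t_pos: "0 < t"
proof -
  have "cone_angle m / 2 < pi/2"
    using cone_angle_half_bounds[OF m8] pi_gt_zero by linarith
  then show ?thesis
    unfolding t_def using cone_angle_half_bounds[OF m8] tan_gt_zero by blast
qed

text \<open>Twice the half angle is at most pi/4, so its tangent is at most 1; the double-angle
  formula turns this into a bound on \<open>t\<close>, which later gives
  \<open>t < 1/2\<close>.\<close>

lemma t_small: "t\<^sup>2 + 2 * t \<le> 1"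
proof -
  define h where "h = cone_angle m / 2"
  have h: "0 < h" "h \<le> pi/8" using cone_angle_half_bounds[OF m8] by (auto simp: h_def)
  have c: "cos h > 0" by (rule cos_gt_zero_pi) (use h pi_gt_zero in linarith)+
  have c2: "cos (2 * h) > 0" by (rule cos_gt_zero_pi) (use h pi_gt_zero in linarith)+
  have "tan (2 * h) \<le> tan (pi/4)" by (rule tan_mono_le) (use h pi_gt_zero in linarith)+
  then have "tan (2 * h) \<le> 1" by (simp add: tan_45)
  then have "sin (2 * h) \<le> cos (2 * h)" using c2 by (simp add: tan_def divide_simps)
  then have "2 * sin h * cos h \<le> (cos h)\<^sup>2 - (sin h)\<^sup>2" by (simp add: sin_double cos_double)
  then have "(2 * sin h * cos h) / (cos h)\<^sup>2 \<le> ((cos h)\<^sup>2 - (sin h)\<^sup>2) / (cos h)\<^sup>2"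
    by (rule divide_right_mono) simp
  then have "2 * tan h \<le> 1 - (tan h)\<^sup>2"
    using c by (simp add: tan_def power2_eq_square field_simps)
  then show ?thesis by (simp add: t_def h_def)
qed

lemma one_plus_t_sq_pos: "0 < 1 + t\<^sup>2" by (simp add: add_pos_nonneg)

lemma axis_lt: "0 < m" "m div 4 < m" "m div 2 < m" "3 * (m div 4) < m"
  using m8 m4 by auto

lemmas axis = projections_axis[OF axis_lt(1) m4]

lemma in_cone_axisI:
  "upof t p q \<Longrightarrow> in_cone m 0 p q"
  "rightof t p q \<Longrightarrow> in_cone m (m div 4) p q"
  "upof t q p \<Longrightarrow> in_cone m (m div 2) p q"
  "rightof t q p \<Longrightarrow> in_cone m (3 * (m div 4)) p q"
  by (rule in_coneI[OF m8]; simp add: axis upof_def rightof_def t_def abs_minus_commute)+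

lemma in_cone_axisD:
  "in_cone m 0 p q \<Longrightarrow> \<bar>fst q - fst p\<bar> \<le> t * (snd q - snd p) \<and> snd p < snd q"
  "in_cone m (m div 4) p q \<Longrightarrow> \<bar>snd q - snd p\<bar> \<le> t * (fst q - fst p) \<and> fst p < fst q"
  "in_cone m (m div 2) p q \<Longrightarrow> \<bar>fst q - fst p\<bar> \<le> t * (snd p - snd q) \<and> snd q < snd p"
  using in_coneD[OF m8, of _ p q] by (force simp: axis t_def abs_minus_commute)+

definition adjacent :: "(real \<times> real) set \<Rightarrow> real \<times> real \<Rightarrow> real \<times> real \<Rightarrow> bool" where
  "adjacent P p q \<longleftrightarrow> theta_edge m P p q \<or> theta_edge m P q p"

lemma adjacent_sym: "adjacent P p q \<longleftrightarrow> adjacent P q p"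
  by (auto simp: adjacent_def)

text \<open>Both directions of the edge must be excluded: \<open>r\<close> beats \<open>q\<close> in
  the upward cone of \<open>p\<close>, and \<open>s\<close> beats \<open>p\<close> in the downward
  cone of \<open>q\<close>.\<close>

lemma not_adjacent_vertical:
  assumes "r \<in> P" "s \<in> P" "upof t p q" "upof t p r" "snd r < snd q" "upof t s q" "snd p < snd s"
  shows "\<not> adjacent P p q"
  unfolding adjacent_def
  using not_theta_edgeI[OF m8 axis_lt(1) assms(1) in_cone_axisI(1)[OF assms(3)] in_cone_axisI(1)[OF assms(4)]]
    not_theta_edgeI[OF m8 axis_lt(3) assms(2) in_cone_axisI(3)[OF assms(3)] in_cone_axisI(3)[OF assms(6)]] assms
  by (simp add: axis)

text \<open>By transitivity of \<open>upof\<close> a single intermediate point serves as both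
  blockers.\<close>

lemma not_adjacent_between:
  assumes "r \<in> P" "upof t p r" "upof t r q"
  shows "\<not> adjacent P p q"
  using assms upof_trans upof_snd[OF t_pos]
  by (intro not_adjacent_vertical[of r P r]) blast+

lemma not_adjacent_horizontal:
  assumes "r \<in> P" "s \<in> P" "rightof t p q" "rightof t p r" "fst r < fst q" "rightof t s q" "fst p < fst s"
  shows "\<not> adjacent P p q"
  unfolding adjacent_def
  using not_theta_edgeI[OF m8 axis_lt(2) assms(1) in_cone_axisI(2)[OF assms(3)] in_cone_axisI(2)[OF assms(4)]]
    not_theta_edgeI[OF m8 axis_lt(4) assms(2) in_cone_axisI(4)[OF assms(3)] in_cone_axisI(4)[OF assms(6)]] assms
  by (simp add: axis)

end

section \<open>Moving points into general position\<close>

lemma negligible_line: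
  assumes "d \<noteq> 0"
  shows "negligible {x::real\<times>real. fst (x - q) * snd d - snd (x - q) * fst d = 0}"
proof -
  have "{x. fst (x - q) * snd d - snd (x - q) * fst d = 0}
      = {x. (snd d, - fst d) \<bullet> x = fst q * snd d - snd q * fst d}"
    by (auto simp: inner_prod_def algebra_simps)
  moreover have "(snd d, - fst d) \<noteq> 0" using assms by (auto simp: prod_eq_iff)
  ultimately show ?thesis using negligible_hyperplane by metis
qed

lemma collinear_3_cross:
  fixes x q r :: "real \<times> real"
  assumes "collinear {x, q, r}"
  shows "fst (x - q) * snd (r - q) - snd (x - q) * fst (r - q) = 0"
proof -
  obtain u where u: "\<forall>y\<in>{x, q, r}. \<forall>z\<in>{x, q, r}. \<exists>c. y - z = c *\<^sub>R u"
    using assms unfolding collinear_def by blast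
  then obtain a b where "x - q = a *\<^sub>R u" "r - q = b *\<^sub>R u" by (metis insertCI)
  then show ?thesis by simp
qed

text \<open>The forbidden positions lie on finitely many lines and points, a null set, so they
  cannot fill a ball.\<close>

lemma general_position_insert:
  assumes fin: "finite Q" and Q: "general_position m Q" and "\<delta> > 0"
  shows "\<exists>p'. dist p' p < \<delta> \<and> p' \<notin> Q \<and> general_position m (insert p' Q)"
proof -
  define bnd where "bnd i = dir (real i * cone_angle m - cone_angle m / 2)" for i
  define bis where "bis i = dir (real i * cone_angle m)" for i
  define L where "L q d = {x. fst (x - q) * snd d - snd (x - q) * fst d = 0}" for q d :: "real \<times> real"
  have nz: "bnd i \<noteq> 0" "bis i \<noteq> 0" "(- snd (bis i), fst (bis i)) \<noteq> 0" for i
    by (auto simp: bnd_def bis_def dir_def prod_eq_iff dest: sin_zero_norm_cos_one)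
  \<comment> \<open>The lines through \<open>q\<close> are parallel to a boundary ray, perpendicular
    to a bisector (hence the quarter turn of \<open>bis i\<close>), or pass through a second point
    \<open>r\<close>.\<close>
  define Bad where "Bad = Q \<union> (\<Union>q\<in>Q. \<Union>i<m. L q (bnd i) \<union> L q (- snd (bis i), fst (bis i)))
     \<union> (\<Union>(q,r)\<in>{(q,r)\<in>Q\<times>Q. q \<noteq> r}. L q (r - q))"
  have "finite {(q,r)\<in>Q\<times>Q. q \<noteq> r}" using fin by (auto intro: finite_subset[of _ "Q\<times>Q"])
  moreover have neg: "negligible (L q d)" if "d \<noteq> 0" for q d
    unfolding L_def using that by (rule negligible_line)
  ultimately have "negligible (\<Union>(q,r)\<in>{(q,r)\<in>Q\<times>Q. q \<noteq> r}. L q (r - q))"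
    by (intro negligible_Union finite_imageI) (auto intro!: neg simp: prod_eq_iff)
  moreover have "negligible (\<Union>i<m. L q (bnd i) \<union> L q (- snd (bis i), fst (bis i)))" for q
    by (rule negligible_Union) (auto intro!: negligible_Un neg nz)
  then have "negligible (\<Union>q\<in>Q. \<Union>i<m. L q (bnd i) \<union> L q (- snd (bis i), fst (bis i)))"
    using fin by (intro negligible_Union finite_imageI) blast+
  ultimately have "negligible Bad"
    unfolding Bad_def using fin by (simp add: negligible_finite)
  moreover have "\<not> negligible (ball p \<delta>)"
    using \<open>\<delta> > 0\<close> by (intro open_not_negligible) auto
  ultimately have "\<not> ball p \<delta> \<subseteq> Bad" using negligible_subset by blast
  then obtain x where "x \<in> ball p \<delta>" and "x \<notin> Bad" by blast
  then have x: "dist x p < \<delta>" "x \<notin> Bad" by (simp_all add: dist_commute)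
  have xQ: "x \<notin> Q" using x by (auto simp: Bad_def)
  have off: "fst (x - q) * snd (bnd i) - snd (x - q) * fst (bnd i) \<noteq> 0"
    "(x - q) \<bullet> bis i \<noteq> 0" if "q \<in> Q" "i < m" for q i
    using x that by (auto simp: Bad_def L_def inner_prod_def)
  have off': "fst (q - x) * snd (bnd i) - snd (q - x) * fst (bnd i) \<noteq> 0"
    "(q - x) \<bullet> bis i \<noteq> 0" if "q \<in> Q" "i < m" for q i
    using off[OF that] by (auto simp: algebra_simps)
  have ncol: "\<not> collinear {x, q, r}" if "q \<in> Q" "r \<in> Q" "q \<noteq> r" for q r
  proof -
    have "x \<notin> L q (r - q)" using x(2) that unfolding Bad_def by blast
    then show ?thesis using collinear_3_cross[of x q r] by (auto simp: L_def)
  qed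
  have "general_position m (insert x Q)"
    unfolding general_position_def
  proof (intro conjI ballI impI allI)
    fix a b i assume ab: "a \<in> insert x Q" "b \<in> insert x Q" "a \<noteq> b" "i < m"
    have "fst (a - b) * snd (bnd i) - snd (a - b) * fst (bnd i) \<noteq> 0 \<and> (a - b) \<bullet> bis i \<noteq> 0"
    proof (cases "a = x \<or> b = x")
      case True
      then show ?thesis using ab off off' by blast
    next
      case False
      then show ?thesis
        using Q ab unfolding general_position_def Let_def bnd_def bis_def by blast
    qed
    then show "let d = dir (real i * cone_angle m - cone_angle m / 2)
         in fst (a - b) * snd d - snd (a - b) * fst d \<noteq> 0"
      "(a - b) \<bullet> dir (real i * cone_angle m) \<noteq> 0"
      by (simp_all add: bnd_def bis_def Let_def)
  next
    fix a b c assume abc: "a \<in> insert x Q" "b \<in> insert x Q" "c \<in> insert x Q"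
      "a \<noteq> b \<and> b \<noteq> c \<and> a \<noteq> c"
    then consider "a = x" "b \<in> Q" "c \<in> Q" | "b = x" "a \<in> Q" "c \<in> Q" | "c = x" "a \<in> Q" "b \<in> Q"
      | "a \<in> Q" "b \<in> Q" "c \<in> Q" by blast
    then show "\<not> collinear {a, b, c}"
    proof cases
      case 4
      then show ?thesis using Q abc unfolding general_position_def by blast
    qed (use ncol abc in \<open>auto simp: insert_commute\<close>)
  qed
  then show ?thesis using x xQ by blast
qed

lemma general_position_dense:
  assumes "finite I" and "\<delta> > 0"
  shows "\<exists>g. (\<forall>i\<in>I. dist (g i) (f i) < \<delta>) \<and> inj_on g I \<and> general_position m (g ` I)"
  using assms(1)
proof induction
  case empty
  then show ?case by (auto simp: general_position_def)
next
  case (insert a I)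
  then obtain g where g: "\<forall>i\<in>I. dist (g i) (f i) < \<delta>" "inj_on g I" "general_position m (g ` I)"
    by blast
  then obtain p where p: "dist p (f a) < \<delta>" "p \<notin> g ` I" "general_position m (insert p (g ` I))"
    using general_position_insert[of "g ` I"] insert.hyps \<open>\<delta> > 0\<close> by blast
  have eq: "g(a := p) ` I = g ` I" using insert.hyps by auto
  show ?case
    using g p insert.hyps eq
    by (intro exI[of _ "g(a := p)"]) (auto simp: inj_on_def)
qed

text \<open>In this form every open condition that holds at \<open>f\<close> also holds at some
  \<open>G n\<close>. Injectivity keeps labels and points interchangeable.\<close>

lemma general_position_sequence:
  fixes f :: "'a \<Rightarrow> real \<times> real"
  assumes "finite (UNIV :: 'a set)"
  shows "\<exists>G. (\<forall>p. (\<lambda>n. G n p) \<longlonglongrightarrow> f p) \<and> (\<forall>n. inj (G n)) \<and> (\<forall>n. general_position m (range (G n)))"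
proof -
  have "\<forall>n. \<exists>g. (\<forall>p\<in>UNIV. dist (g p) (f p) < inverse (real (Suc n))) \<and> inj g \<and> general_position m (range g)"
    by (intro allI general_position_dense[OF assms]) simp
  from choice[OF this] obtain G where
    G: "\<forall>n. (\<forall>p\<in>UNIV. dist (G n p) (f p) < inverse (real (Suc n))) \<and> inj (G n) \<and> general_position m (range (G n))" ..
  then have "dist (G n p) (f p) \<le> inverse (real (Suc n))" for n p
    by (simp add: less_imp_le)
  then have "(\<lambda>n. G n p) \<longlonglongrightarrow> f p" for p
    unfolding tendsto_dist_iff[of _ "f p"]
    by (intro real_tendsto_sandwich[OF _ _ tendsto_const LIMSEQ_inverse_real_of_nat] always_eventually) auto
  with G show ?thesis by blast
qed

section \<open>Lower bounds on path length from a potential\<close>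

lemma path_length_ge_potential:
  fixes \<Phi> :: "real \<times> real \<Rightarrow> real"
  assumes edge: "\<And>p q. theta_edge m P p q \<Longrightarrow> \<bar>\<Phi> p - \<Phi> q\<bar> \<le> dist p q"
    and path: "theta_path m P ps u w"
  shows "\<Phi> w - \<Phi> u \<le> path_length ps"
proof -
  have ps: "ps \<noteq> []" "hd ps = u" "last ps = w" using path by (auto simp: theta_path_def)
  have "\<Phi> w - \<Phi> u = (\<Sum>j < length ps - 1. \<Phi> (ps ! Suc j) - \<Phi> (ps ! j))"
    using ps sum_lessThan_telescope[of "\<lambda>j. \<Phi> (ps ! j)" "length ps - 1"]
    by (simp add: hd_conv_nth last_conv_nth)
  also have "\<dots> \<le> path_length ps"
    unfolding path_length_def
  proof (rule sum_mono)
    fix j assume "j \<in> {..<length ps - 1}"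
    then have "theta_edge m P (ps ! j) (ps ! Suc j) \<or> theta_edge m P (ps ! Suc j) (ps ! j)"
      using path by (auto simp: theta_path_def)
    then show "\<Phi> (ps ! Suc j) - \<Phi> (ps ! j) \<le> dist (ps ! j) (ps ! Suc j)"
      using edge by (metis abs_le_D1 abs_minus_commute dist_commute)
  qed
  finally show ?thesis .
qed

section \<open>The twelve points and the pairs that may be joined\<close>

datatype site = W | A | B | V | X | Y

text \<open>Bot x is the image of Top x under the central reflection swapping u and w; thus w is Top W
  and u is Bot W.\<close>

datatype vertex = Top site | Bot site

lemma UNIV_site: "UNIV = {W, A, B, V, X, Y}"
  using site.exhaust by auto

lemma UNIV_vertex: "UNIV = Top ` UNIV \<union> Bot ` UNIV"
  by (metis UNIV_eq_I UnCI rangeI vertex.exhaust)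

lemma finite_vertex: "finite (UNIV :: vertex set)"
  by (simp add: UNIV_vertex UNIV_site)

lemma all_site: "(\<forall>x. Q x) \<longleftrightarrow> Q W \<and> Q A \<and> Q B \<and> Q V \<and> Q X \<and> Q Y"
  by (metis site.exhaust)

lemma all_vertex: "(\<forall>x. Q x) \<longleftrightarrow> (\<forall>x. Q (Top x)) \<and> (\<forall>x. Q (Bot x))"
  by (metis vertex.exhaust)

text \<open>Pairs on one side: \<open>Y\<close> separates \<open>A\<close> from \<open>B\<close>,
  and \<open>X\<close> separates \<open>W\<close> from \<open>V\<close>. The four pairs between
  \<open>A\<close>, \<open>Y\<close> and \<open>W\<close>, \<open>X\<close> are cut off by
  \<open>V\<close> seen from the left and by \<open>B\<close> seen from the right.\<close>

fun blocked :: "site \<Rightarrow> site \<Rightarrow> bool" where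
  "blocked A B = True" | "blocked B A = True"
| "blocked W V = True" | "blocked V W = True"
| "blocked A W = True" | "blocked W A = True"
| "blocked A X = True" | "blocked X A = True"
| "blocked Y W = True" | "blocked W Y = True"
| "blocked Y X = True" | "blocked X Y = True"
| "blocked _ _ = False"

text \<open>Here \<open>x\<close> is a \<open>Top\<close> point and \<open>y\<close> a
  \<open>Bot\<close> point. All other pairs across are blocked by u, by w or by a corner
  \<open>A\<close>; the pair uw needs both corners.\<close>

fun crossing :: "site \<Rightarrow> site \<Rightarrow> bool" where
  "crossing x y \<longleftrightarrow> x \<in> {A, B, Y} \<and> y \<in> {A, B, Y} \<or> x = A \<and> y = W \<or> x = W \<and> y = A"

text \<open>A superset of the edges: the potential is only compared with distances on these
  pairs.\<close>

fun linked :: "vertex \<Rightarrow> vertex \<Rightarrow> bool" where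
  "linked (Top x) (Top y) = (\<not> blocked x y)"
| "linked (Bot x) (Bot y) = (\<not> blocked x y)"
| "linked (Top x) (Bot y) = crossing x y"
| "linked (Bot x) (Top y) = crossing y x"

text \<open>\<open>h\<close> is one side and \<open>h'\<close> the opposite one, so
  \<open>h' W\<close> is the far endpoint. The \<open>upof\<close> and \<open>rightof\<close> chains
  and the comparisons after them provide the blockers; the last line keeps \<open>V\<close> the
  leftmost candidate in the rightward cone of \<open>A\<close>, which makes AV an edge.\<close>

definition half :: "real \<Rightarrow> (site \<Rightarrow> real \<times> real) \<Rightarrow> (site \<Rightarrow> real \<times> real) \<Rightarrow> bool" where
  "half t h h' \<longleftrightarrow>
     upof t (h' W) (h A) \<and> upof t (h A) (h Y) \<and> upof t (h Y) (h B) \<and>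
     upof t (h' W) (h W) \<and> upof t (h W) (h X) \<and> upof t (h X) (h V) \<and>
     snd (h A) < snd (h W) \<and>
     rightof t (h A) (h W) \<and> rightof t (h A) (h X) \<and> rightof t (h A) (h V) \<and>
     rightof t (h Y) (h W) \<and> rightof t (h Y) (h X) \<and> rightof t (h Y) (h V) \<and>
     rightof t (h B) (h W) \<and> rightof t (h B) (h X) \<and> rightof t (h B) (h V) \<and>
     fst (h V) < fst (h W) \<and> fst (h V) < fst (h X) \<and>
     fst (h A) < fst (h B) \<and> fst (h Y) < fst (h B) \<and>
     fst (h V) < fst (h' A) \<and> fst (h V) < fst (h' B) \<and> fst (h V) < fst (h' Y)"

text \<open>Negation turns the reflected configuration into one with the same inequalities, up to a
  translation that they do not see.\<close>

definition admissible :: "real \<Rightarrow> (vertex \<Rightarrow> real \<times> real) \<Rightarrow> bool" where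
  "admissible t g \<longleftrightarrow> half t (\<lambda>x. g (Top x)) (\<lambda>x. g (Bot x)) \<and>
     half t (\<lambda>x. - g (Bot x)) (\<lambda>x. - g (Top x))"

lemma upof_uminus [simp]: "upof t (- p) (- q) \<longleftrightarrow> upof t q p"
  by (simp add: upof_def abs_minus_commute)

lemma rightof_uminus [simp]: "rightof t (- p) (- q) \<longleftrightarrow> rightof t q p"
  by (simp add: rightof_def abs_minus_commute)

section \<open>Edges and a path in an admissible configuration\<close>

context quadrant_cones begin

lemma linked_if_adjacent:
  assumes g: "admissible t g" and adj: "adjacent (range g) (g p) (g q)"
  shows "linked p q"
proof (rule ccontr)
  assume nl: "\<not> linked p q"
  have h: "half t (\<lambda>x. g (Top x)) (\<lambda>x. g (Bot x))" "half t (\<lambda>x. - g (Bot x)) (\<lambda>x. - g (Top x))"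
    using g by (auto simp: admissible_def)
  note f = h[unfolded half_def upof_uminus rightof_uminus fst_uminus snd_uminus neg_less_iff_less]
  let ?N = "\<lambda>p q. \<not> adjacent (range g) (g p) (g q)"
  have betw: "?N p q" if "upof t (g p) (g r)" "upof t (g r) (g q)" for p q r
    using that not_adjacent_between[of "g r" "range g"] by blast
  have top: "?N (Top A) (Top B)" "?N (Top W) (Top V)"
    and bot: "?N (Bot B) (Bot A)" "?N (Bot V) (Bot W)"
    using f betw[of "Top A" "Top Y" "Top B"] betw[of "Top W" "Top X" "Top V"]
      betw[of "Bot B" "Bot Y" "Bot A"] betw[of "Bot V" "Bot X" "Bot W"] by auto
  \<comment> \<open>\<open>V\<close> is a closer rightward neighbour for \<open>x\<close>, and
    \<open>B\<close> a closer leftward neighbour for \<open>y\<close>.\<close>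
  have toph: "?N (Top x) (Top y)" if "x \<in> {A, Y}" "y \<in> {W, X}" for x y
    using that f not_adjacent_horizontal[of "g (Top V)" "range g" "g (Top B)" "g (Top x)" "g (Top y)"]
    by auto
  have both: "?N (Bot y) (Bot x)" if "x \<in> {A, Y}" "y \<in> {W, X}" for x y
    using that f not_adjacent_horizontal[of "g (Bot B)" "range g" "g (Bot V)" "g (Bot y)" "g (Bot x)"]
    by auto
  \<comment> \<open>The upper corner blocks the view from u, the lower corner the view from
    w.\<close>
  have uw: "?N (Bot W) (Top W)"
    using f not_adjacent_vertical[of "g (Top A)" "range g" "g (Bot A)" "g (Bot W)" "g (Top W)"]
    by auto
  have lowU: "upof t (g (Bot x)) (g (Bot W))" if "x \<in> {V, X}" for x
    using f that upof_trans[of t "g (Bot V)" "g (Bot X)" "g (Bot W)"] by auto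
  have lowA: "upof t (g (Bot x)) (g (Bot A))" if "x \<in> {B, Y}" for x
    using f that upof_trans[of t "g (Bot B)" "g (Bot Y)" "g (Bot A)"] by auto
  have upW: "upof t (g (Top W)) (g (Top x))" if "x \<in> {V, X}" for x
    using f that upof_trans[of t "g (Top W)" "g (Top X)" "g (Top V)"] by auto
  have upA: "upof t (g (Top A)) (g (Top x))" if "x \<in> {B, Y}" for x
    using f that upof_trans[of t "g (Top A)" "g (Top Y)" "g (Top B)"] by auto
  have UW: "upof t (g (Bot W)) (g (Top W))" "upof t (g (Bot W)) (g (Top A))" "upof t (g (Bot A)) (g (Top W))"
    using f by auto
  \<comment> \<open>All \<open>Top\<close> points lie in the upward cone of u and all
    \<open>Bot\<close> points in the downward cone of w, so u and w themselves separate most pairs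
    across.\<close>
  have U: "upof t (g (Bot W)) (g (Top x))" for x
    using UW upW upA upof_trans by (cases x) blast+
  have W: "upof t (g (Bot x)) (g (Top W))" for x
    using UW lowU lowA upof_trans by (cases x) blast+
  have c1: "?N (Bot y) (Top x)" if "y \<in> {V, X}" for x y
    using betw[OF lowU[OF that] U] .
  have c2: "?N (Bot y) (Top x)" if "x \<in> {V, X}" for x y
    using betw[OF W upW[OF that]] .
  have c3: "?N (Bot y) (Top W)" if "y \<in> {B, Y}" for y
    using betw[OF lowA[OF that]] UW by blast
  have c4: "?N (Bot W) (Top x)" if "x \<in> {B, Y}" for x
    using betw[OF _ upA[OF that]] UW by blast
  have cr: "?N (Bot y) (Top x)" if "\<not> crossing x y" for x y
    using that c1 c2 c3 c4 uw by (cases x; cases y) simp_all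
  have sym: "?N q p" if "?N p q" for p q
    using that adjacent_sym by blast
  have st: "?N (Top x) (Top y)" if "blocked x y" for x y
    using that top toph top[THEN sym] toph[THEN sym] by (cases x; cases y) simp_all
  have sb: "?N (Bot x) (Bot y)" if "blocked x y" for x y
    using that bot both bot[THEN sym] both[THEN sym] by (cases x; cases y) simp_all
  have "?N p q" if "\<not> linked p q" for p q
  proof (cases p; cases q)
    fix x y assume "p = Top x" "q = Top y" then show ?thesis using that st by simp
  next
    fix x y assume "p = Bot x" "q = Bot y" then show ?thesis using that sb by simp
  next
    fix x y assume "p = Bot x" "q = Top y" then show ?thesis
      using that cr[of y x] by auto
  next
    fix x y assume "p = Top x" "q = Bot y" then show ?thesis
      using that cr[of x y, THEN sym] by auto
  qed
  then show False using nl adj by blast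
qed

lemma theta_edge_coneI:
  assumes "i < m" "in_cone m i p q" "p \<in> P" "q \<in> P"
    "\<And>r. r \<in> P \<Longrightarrow> in_cone m i p r \<Longrightarrow> bis_proj m i p q \<le> bis_proj m i p r"
  shows "theta_edge m P p q"
  using assms unfolding theta_edge_def by blast

lemma theta_edge_axisI:
  "p \<in> P \<Longrightarrow> q \<in> P \<Longrightarrow> upof t p q \<Longrightarrow>
    (\<And>r. r \<in> P \<Longrightarrow> in_cone m 0 p r \<Longrightarrow> snd q \<le> snd r) \<Longrightarrow> theta_edge m P p q"
  "p \<in> P \<Longrightarrow> q \<in> P \<Longrightarrow> rightof t p q \<Longrightarrow>
    (\<And>r. r \<in> P \<Longrightarrow> in_cone m (m div 4) p r \<Longrightarrow> fst q \<le> fst r) \<Longrightarrow> theta_edge m P p q"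
  "p \<in> P \<Longrightarrow> q \<in> P \<Longrightarrow> upof t q p \<Longrightarrow>
    (\<And>r. r \<in> P \<Longrightarrow> in_cone m (m div 2) p r \<Longrightarrow> snd r \<le> snd q) \<Longrightarrow> theta_edge m P p q"
  using theta_edge_coneI[of 0 p q P] theta_edge_coneI[of "m div 4" p q P]
    theta_edge_coneI[of "m div 2" p q P] in_cone_axisI[of p q] in_cone_axisI[of q p]
  by (simp_all only: axis axis_lt neg_le_iff_le diff_right_mono diff_left_mono)

lemma not_in_cone:
  "upof t p q \<Longrightarrow> \<not> in_cone m (m div 4) p q"
  "upof t q p \<Longrightarrow> \<not> in_cone m (m div 4) p q"
  "rightof t p q \<Longrightarrow> \<not> in_cone m 0 p q"
  "rightof t q p \<Longrightarrow> \<not> in_cone m (m div 2) p q"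
  "rightof t q p \<Longrightarrow> \<not> in_cone m 0 p q"
  "rightof t p q \<Longrightarrow> \<not> in_cone m (m div 2) p q"
proof -
  obtain j where "m = 4 * j" "j \<ge> 2" using m4 m8 by (auto elim!: dvdE)
  then have d: "m div 4 \<noteq> 0" "m div 2 \<noteq> 0" "m div 4 \<noteq> m div 2" "m div 4 \<noteq> 3 * (m div 4)"
    "3 * (m div 4) \<noteq> 0" "3 * (m div 4) \<noteq> m div 2" by auto
  have u: "\<not> in_cone m j p q" if "in_cone m i p q" "i \<noteq> j" "i < m" "j < m" for i j
    using in_cone_unique[OF axis_lt(1)] that by blast
  show "upof t p q \<Longrightarrow> \<not> in_cone m (m div 4) p q"
    using u[OF in_cone_axisI(1)] d axis_lt by simp
  show "upof t q p \<Longrightarrow> \<not> in_cone m (m div 4) p q"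
    using u[OF in_cone_axisI(3)] d axis_lt by simp
  show "rightof t p q \<Longrightarrow> \<not> in_cone m 0 p q" "rightof t p q \<Longrightarrow> \<not> in_cone m (m div 2) p q"
    using u[OF in_cone_axisI(2)] d axis_lt by simp_all
  show "rightof t q p \<Longrightarrow> \<not> in_cone m (m div 2) p q" "rightof t q p \<Longrightarrow> \<not> in_cone m 0 p q"
    using u[OF in_cone_axisI(4)] d axis_lt by (metis, metis)
qed

text \<open>Guarantees that u and w are connected, so that the bound is about an existing path. In
  each step the target has the least projection in an axis cone: up, right, down, down.\<close>

lemma theta_path_if_admissible:
  assumes g: "admissible t g"
  shows "theta_path m (range g) [g (Bot W), g (Top A), g (Top V), g (Top X), g (Top W)] (g (Bot W)) (g (Top W))"
proof -
  have h: "half t (\<lambda>x. g (Top x)) (\<lambda>x. g (Bot x))" "half t (\<lambda>x. - g (Bot x)) (\<lambda>x. - g (Top x))"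
    using g by (auto simp: admissible_def)
  note f = h[unfolded half_def upof_uminus rightof_uminus fst_uminus snd_uminus neg_less_iff_less]
  have lt: "snd p < snd q" if "upof t p q" for p q using upof_snd[OF t_pos that] .
  have ord: "snd (g (Top A)) < snd (g (Top Y))" "snd (g (Top Y)) < snd (g (Top B))"
    "snd (g (Top A)) < snd (g (Top W))" "snd (g (Top W)) < snd (g (Top X))" "snd (g (Top X)) < snd (g (Top V))"
    "snd (g (Bot V)) < snd (g (Bot X))" "snd (g (Bot X)) < snd (g (Bot W))"
    "snd (g (Bot B)) < snd (g (Bot Y))" "snd (g (Bot Y)) < snd (g (Bot A))"
    "snd (g (Bot A)) < snd (g (Top W))" "snd (g (Bot W)) < snd (g (Top W))"
    using f by (auto intro: lt)
  have up: "upof t (g (Bot x)) (g (Top A))" if "x \<in> {W, V, X}" for x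
  proof -
    have 1: "upof t (g (Bot W)) (g (Top A))" using f by simp
    have 2: "upof t (g (Bot X)) (g (Top A))" using upof_trans[OF _ 1] f by simp
    have 3: "upof t (g (Bot V)) (g (Top A))" using upof_trans[OF _ 2] f by simp
    show ?thesis using that 1 2 3 by auto
  qed
  have up': "upof t (g (Top A)) (g (Top B))" using f upof_trans[of t _ "g (Top Y)"] by simp
  have below: "snd q < snd p" if "in_cone m (m div 2) p q" for p q using in_cone_axisD(3)[OF that] by simp
  have higher: "snd p < snd q" if "in_cone m 0 p q" for p q using in_cone_axisD(1)[OF that] by simp
  have right: "fst p < fst q" if "in_cone m (m div 4) p q" for p q using in_cone_axisD(2)[OF that] by simp
  have 1: "\<not> in_cone m 0 (g (Bot W)) (g (Bot x))" if "x \<in> {A, B, Y}" for x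
    using that f by (intro not_in_cone(3)) auto
  have 2: "\<not> in_cone m 0 (g (Bot W)) (g (Bot x))" if "x \<in> {W, V, X}" for x
    using that ord higher[of "g (Bot W)" "g (Bot x)"] by auto
  \<comment> \<open>No \<open>Bot\<close> point competes: \<open>A\<close>, \<open>B\<close>,
    \<open>Y\<close> are to the right of u, the others are not above it. Among the
    \<open>Top\<close> points \<open>A\<close> is lowest.\<close>
  have "\<forall>q. in_cone m 0 (g (Bot W)) (g q) \<longrightarrow> snd (g (Top A)) \<le> snd (g q)"
    unfolding all_vertex all_site using ord by (simp add: 1 2)
  then have UA: "theta_edge m (range g) (g (Bot W)) (g (Top A))"
    using f by (intro theta_edge_axisI(1)) auto
  have 3: "\<not> in_cone m (m div 4) (g (Top A)) (g (Bot x))" if "x \<in> {W, V, X}" for x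
    using not_in_cone(2)[OF up[OF that]] .
  have 4: "\<not> in_cone m (m div 4) (g (Top A)) (g (Top x))" if "x \<in> {B, Y}" for x
    using that f up' by (intro not_in_cone(1)) auto
  have 5: "\<not> in_cone m (m div 4) (g (Top A)) (g (Top A))"
    using right by blast
  have "\<forall>q. in_cone m (m div 4) (g (Top A)) (g q) \<longrightarrow> fst (g (Top V)) \<le> fst (g q)"
    unfolding all_vertex all_site using f by (simp add: 3 4 5)
  then have AV: "theta_edge m (range g) (g (Top A)) (g (Top V))"
    using f by (intro theta_edge_axisI(2)) auto
  have 6: "\<not> in_cone m (m div 2) (g (Top y)) (g (Top x))" if "x \<in> {A, B, Y}" "y \<in> {V, X}" for x y
    using that f by (intro not_in_cone(4)) auto
  have 7: "\<not> in_cone m (m div 2) (g (Top x)) (g (Top V))" if "x \<in> {V, X}" for x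
    using that ord below[of "g (Top x)" "g (Top V)"] by auto
  have 8: "\<not> in_cone m (m div 2) (g (Top X)) (g (Top X))"
    using below by blast
  have "\<forall>q. in_cone m (m div 2) (g (Top V)) (g q) \<longrightarrow> snd (g q) \<le> snd (g (Top X))"
    unfolding all_vertex all_site using ord by (simp add: 6 7)
  then have VX: "theta_edge m (range g) (g (Top V)) (g (Top X))"
    using f by (intro theta_edge_axisI(3)) auto
  have "\<forall>q. in_cone m (m div 2) (g (Top X)) (g q) \<longrightarrow> snd (g q) \<le> snd (g (Top W))"
    unfolding all_vertex all_site using ord by (simp add: 6 7 8)
  then have XW: "theta_edge m (range g) (g (Top X)) (g (Top W))"
    using f by (intro theta_edge_axisI(3)) auto
  show ?thesis
    using UA AV VX XW by (auto simp: theta_path_def less_Suc_eq numeral_eq_Suc)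
qed

end

section \<open>Coordinates of the configuration\<close>

text \<open>Half the height of \<open>V\<close> above w, \<open>t * t\<close> in the limit. The
  correction makes the rise from \<open>A\<close> to \<open>V\<close> equal to
  \<open>t * (2 * t - 3 * e) - e\<close>, so \<open>V\<close> is inside the rightward cone of
  \<open>A\<close> with slack \<open>e\<close>.\<close>

definition half_height :: "real \<Rightarrow> real \<Rightarrow> real" where
  "half_height t e = t * t - 3/2 * (t * e) - e"

text \<open>The limit positions are those at e = 0; each of them lies on the boundary of cones of others,
  and the terms in e push it into the cones where it is needed.\<close>

fun place :: "real \<Rightarrow> real \<Rightarrow> site \<Rightarrow> real \<times> real" where
  "place t e W = (t - e, 1)"
| "place t e A = (- t + e, 1 - e)"
| "place t e B = (- t + 2 * e, 1 + 2 * half_height t e)"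
| "place t e V = (t - 2 * e, 1 + 2 * half_height t e)"
| "place t e X = (t - 3 * e + t * half_height t e, 1 + half_height t e)"
| "place t e Y = (- t + 3 * e - t * half_height t e, 1 + half_height t e)"

fun conf :: "real \<Rightarrow> real \<Rightarrow> vertex \<Rightarrow> real \<times> real" where
  "conf t e (Top x) = place t e x"
| "conf t e (Bot x) = place t e W - place t e x"

lemma admissible_conf:
  assumes t: "0 < t" "t < 1/2" and e: "0 < e" "e < t ^ 3 / 20"
  shows "admissible t (conf t e)"
proof -
  define h where "h = half_height t e"
  have hd: "h = t * t - 3/2 * (t * e) - e" by (simp add: h_def half_height_def)
  have te: "0 < t * e" "2 * (t * e) < e" using t e by auto
  have t3: "t ^ 3 = t * (t * t)" by (simp add: power3_eq_cube)
  have "t * (t * t) < 1/2 * (t * t)" using t by (intro mult_strict_right_mono) auto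
  then have e2: "40 * e < t * t" using e unfolding t3 by linarith
  have th: "t * h = t * (t * t) - 3/2 * (t * (t * e)) - t * e"
    unfolding hd by (simp add: algebra_simps)
  have tte: "t * (t * e) < t * e" "0 < t * (t * e)" using te t by auto
  \<comment> \<open>The sideways shift \<open>t * h\<close> of \<open>X\<close> and \<open>Y\<close>
    outweighs the terms in \<open>e\<close>; this is where the cubic bound on \<open>e\<close>
    enters.\<close>
  have th2: "5 * e < t * h" using th e te tte unfolding t3 by linarith
  have h: "0 < h" using th2 e t by (meson less_trans mult_pos_pos zero_less_numeral zero_less_mult_pos)
  have tth: "0 < t * (t * h)" using th2 e t by simp
  have tt: "2 * (t * t) < t" using t by simp
  have hd': "h \<le> t * t - 3/2 * (t * e) - e" "t * t - 3/2 * (t * e) - e \<le> h"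
    using hd by simp_all
  \<comment> \<open>With products as atoms, all required inequalities are linear in these
    facts.\<close>
  note ar = hd' te e2 th2 tth h e(1) tte tt t
  show ?thesis
    unfolding admissible_def half_def upof_def rightof_def abs_less_iff
    by (simp add: algebra_simps flip: h_def) (insert ar, simp only: mult_ac, intro conjI TrueI; linarith)
qed

section \<open>The potential on the limit configuration\<close>

text \<open>Distances from u along the intended path, in units of the length of uw; the values at B and Y
  are chosen so that the edges W B, B Y and Y A respect the potential.\<close>

fun level :: "real \<Rightarrow> site \<Rightarrow> real" where
  "level t W = 1 + 2 * t + 2 * t ^ 2"
| "level t A = 1"
| "level t B = 1 + 2 * t ^ 2"
| "level t V = 1 + 2 * t"
| "level t X = 1 + 2 * t + t ^ 2"
| "level t Y = 1 + t ^ 2"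

fun potential :: "real \<Rightarrow> vertex \<Rightarrow> real" where
  "potential t (Top x) = level t x"
| "potential t (Bot x) = level t W - level t x"

lemma dist_sq: "(dist p q)\<^sup>2 = (fst p - fst q)\<^sup>2 + (snd p - snd q)\<^sup>2" for p q :: "real \<times> real"
  by (simp add: dist_prod_def dist_real_def)

text \<open>The slack \<open>D\<close> vanishes on the path edges AV, VX, XW and on their mirror
  images BW, BY, YA. The other unblocked pairs are the diagonals VB, VY, BX, where it factors into
  nonnegative terms.\<close>

lemma level_le_dist:
  assumes t: "0 < t" "t < 1/2" and xy: "\<not> blocked x y"
  shows "(level t x - level t y)\<^sup>2 * (1 + t\<^sup>2) \<le> (dist (place t 0 x) (place t 0 y))\<^sup>2"
proof -
  define D where "D x y = (fst (place t 0 x) - fst (place t 0 y))\<^sup>2 + (snd (place t 0 x) - snd (place t 0 y))\<^sup>2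
     - (level t x - level t y)\<^sup>2 * (1 + t\<^sup>2)" for x y
  have sym: "D x y = D y x" for x y by (simp add: D_def power2_commute)
  note ev = D_def half_height_def power2_eq_square algebra_simps
  have "D x x = 0" for x by (simp add: D_def)
  moreover have "D A V = 0" "D W B = 0" "D A Y = 0" "D B Y = 0" "D W X = 0" "D V X = 0"
    by (simp_all add: ev)
  moreover have "D V B \<ge> 0"
  proof -
    have "D V B = 4 * t\<^sup>2 * (t * (2 * (1 - t) + t\<^sup>2 * (2 - t)))"
      by (simp add: ev)
    also have "\<dots> \<ge> 0" using t by (intro mult_nonneg_nonneg add_nonneg_nonneg) auto
    finally show ?thesis .
  qed
  moreover have "D V Y = 4 * t ^ 3 * (1 + t\<^sup>2)" "D B X = 4 * t ^ 3 * (1 + t\<^sup>2)"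
    by (simp_all add: ev power3_eq_cube)
  then have "D V Y \<ge> 0" "D B X \<ge> 0" using t by auto
  ultimately have "D x y \<ge> 0"
    using xy sym[of x y] by (cases x; cases y) (simp_all del: place.simps level.simps)
  then show ?thesis by (simp add: D_def dist_sq)
qed

lemma potential_le_dist:
  assumes t: "0 < t" "t < 1/2" and pq: "linked p q"
  shows "sqrt (1 + t\<^sup>2) * \<bar>potential t p - potential t q\<bar> \<le> dist (conf t 0 p) (conf t 0 q)"
proof -
  \<comment> \<open>The left side is the potential difference between \<open>Top x\<close> and
    \<open>Bot y\<close>. It is tight for uA and its reflection.\<close>
  have cross: "(level t x + level t y - level t W)\<^sup>2 * (1 + t\<^sup>2)
       \<le> (dist (place t 0 x) (place t 0 W - place t 0 y))\<^sup>2" if "crossing x y" for x y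
  proof (cases "x = W \<or> y = W")
    case True
    then show ?thesis using that unfolding dist_sq by (auto simp: power2_eq_square algebra_simps)
  next
    case False
    then have xy: "x \<in> {A, B, Y}" "y \<in> {A, B, Y}" using that by auto
    have "t * t < 1 / 2 * t" using t by (intro mult_strict_right_mono)
    moreover have "0 < t * t" "0 < t * (t * t)" using t by simp_all
    ultimately have tt: "t * t < 1 / 2 * t" "0 < t * t" "0 < t * (t * t)" .
    \<comment> \<open>The potential changes by at most 1, whereas these points are at least 3t apart
      horizontally and 1 vertically.\<close>
    have "\<bar>level t x + level t y - level t W\<bar> \<le> 1"
      unfolding abs_le_iff using t tt xy by (elim insertE emptyE; simp add: power2_eq_square; linarith)
    then have "(level t x + level t y - level t W)\<^sup>2 \<le> 1" by (simp add: abs_square_le_1)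
    then have "(level t x + level t y - level t W)\<^sup>2 * (1 + t\<^sup>2) \<le> 1 * (1 + t\<^sup>2)"
      by (intro mult_right_mono) auto
    also have "\<dots> \<le> (3 * t)\<^sup>2 + 1\<^sup>2" by (simp add: power_mult_distrib)
    also have "\<dots> \<le> (fst (place t 0 x) - fst (place t 0 W - place t 0 y))\<^sup>2
        + (snd (place t 0 x) - snd (place t 0 W - place t 0 y))\<^sup>2"
    proof (intro add_mono)
      have "3 * t \<le> - (fst (place t 0 x) - fst (place t 0 W - place t 0 y))"
        using t tt xy by (elim insertE emptyE; simp add: half_height_def; linarith)
      then have "(3 * t)\<^sup>2 \<le> (- (fst (place t 0 x) - fst (place t 0 W - place t 0 y)))\<^sup>2"
        using t by (intro power_mono) auto
      then show "(3 * t)\<^sup>2 \<le> (fst (place t 0 x) - fst (place t 0 W - place t 0 y))\<^sup>2"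
        by (simp only: power2_minus)
      have "1 \<le> snd (place t 0 x) - snd (place t 0 W - place t 0 y)"
        using t tt xy by (elim insertE emptyE; simp add: half_height_def; linarith)
      then show "1\<^sup>2 \<le> (snd (place t 0 x) - snd (place t 0 W - place t 0 y))\<^sup>2"
        by (intro power_mono) auto
    qed
    finally show ?thesis by (simp add: dist_sq)
  qed
  have "(potential t p - potential t q)\<^sup>2 * (1 + t\<^sup>2) \<le> (dist (conf t 0 p) (conf t 0 q))\<^sup>2"
  proof (cases p; cases q)
    fix x y assume [simp]: "p = Top x" "q = Top y"
    then show ?thesis using level_le_dist[OF t] pq by simp
  next
    fix x y assume [simp]: "p = Bot x" "q = Bot y"
    then show ?thesis using level_le_dist[OF t, of x y] pq
      by (simp add: dist_sq power2_commute del: place.simps level.simps)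
  next
    fix x y assume [simp]: "p = Top x" "q = Bot y"
    then show ?thesis using cross[of x y] pq by (simp add: algebra_simps del: place.simps level.simps)
  next
    fix x y assume [simp]: "p = Bot x" "q = Top y"
    then show ?thesis using cross[of y x] pq
      by (simp add: dist_sq power2_commute algebra_simps del: place.simps level.simps)
  qed
  then have "sqrt ((potential t p - potential t q)\<^sup>2 * (1 + t\<^sup>2)) \<le> dist (conf t 0 p) (conf t 0 q)"
    by (simp add: real_le_lsqrt)
  then show ?thesis by (simp add: real_sqrt_mult mult.commute)
qed

section \<open>Stability of the conditions under small moves\<close>

lemma tendsto_conf: "((\<lambda>e. conf t e p) \<longlongrightarrow> conf t 0 p) (at_right 0)"
proof -
  have "((\<lambda>e. place t e x) \<longlongrightarrow> place t 0 x) (at_right 0)" for x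
    by (cases x) (auto simp: half_height_def intro!: tendsto_eq_intros)
  then show ?thesis by (cases p) (auto intro!: tendsto_diff simp del: place.simps)
qed

lemma eventually_less_tendsto:
  fixes f g :: "'a \<Rightarrow> real"
  assumes "(f \<longlongrightarrow> p) F" "(g \<longlongrightarrow> q) F" "p < q"
  shows "\<forall>\<^sub>F n in F. f n < g n"
  using order_tendstoD(1)[OF tendsto_diff[OF assms(2,1)], of 0] assms(3) by simp

lemma eventually_upof:
  assumes "(f \<longlongrightarrow> p) F" "(g \<longlongrightarrow> q) F" "upof t p q"
  shows "\<forall>\<^sub>F n in F. upof t (f n) (g n)"
  unfolding upof_def
  by (rule eventually_less_tendsto[OF _ _ assms(3)[unfolded upof_def]]; intro tendsto_intros assms)

lemma eventually_rightof:
  assumes "(f \<longlongrightarrow> p) F" "(g \<longlongrightarrow> q) F" "rightof t p q"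
  shows "\<forall>\<^sub>F n in F. rightof t (f n) (g n)"
  unfolding rightof_def
  by (rule eventually_less_tendsto[OF _ _ assms(3)[unfolded rightof_def]]; intro tendsto_intros assms)

text \<open>Each conjunct is a strict inequality between continuous functions of the positions,
  hence an open condition.\<close>

lemma eventually_half:
  assumes "\<And>x. ((\<lambda>n. f n x) \<longlongrightarrow> h x) F" "\<And>x. ((\<lambda>n. f' n x) \<longlongrightarrow> h' x) F" "half t h h'"
  shows "\<forall>\<^sub>F n in F. half t (f n) (f' n)"
proof -
  have up1: "\<forall>\<^sub>F n in F. upof t (f n x) (f n y)" if "upof t (h x) (h y)" for x y
    using eventually_upof[OF assms(1) assms(1) that] .
  have up2: "\<forall>\<^sub>F n in F. upof t (f' n x) (f n y)" if "upof t (h' x) (h y)" for x y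
    using eventually_upof[OF assms(2) assms(1) that] .
  have right: "\<forall>\<^sub>F n in F. rightof t (f n x) (f n y)" if "rightof t (h x) (h y)" for x y
    using eventually_rightof[OF assms(1) assms(1) that] .
  have height: "\<forall>\<^sub>F n in F. snd (f n x) < snd (f n y)" if "snd (h x) < snd (h y)" for x y
    using eventually_less_tendsto[OF tendsto_snd[OF assms(1)] tendsto_snd[OF assms(1)] that] .
  have fst1: "\<forall>\<^sub>F n in F. fst (f n x) < fst (f n y)" if "fst (h x) < fst (h y)" for x y
    using eventually_less_tendsto[OF tendsto_fst[OF assms(1)] tendsto_fst[OF assms(1)] that] .
  have fst2: "\<forall>\<^sub>F n in F. fst (f n x) < fst (f' n y)" if "fst (h x) < fst (h' y)" for x y
    using eventually_less_tendsto[OF tendsto_fst[OF assms(1)] tendsto_fst[OF assms(2)] that] .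
  show ?thesis
    unfolding half_def eventually_conj_iff
    by (insert assms(3)[unfolded half_def], elim conjE, intro conjI)
      ((rule up1 up2 right height fst1 fst2; assumption)+)
qed

lemma eventually_admissible:
  assumes "\<And>p. ((\<lambda>n. f n p) \<longlongrightarrow> g p) F" "admissible t g"
  shows "\<forall>\<^sub>F n in F. admissible t (f n)"
proof -
  have "\<forall>\<^sub>F n in F. half t (\<lambda>x. f n (Top x)) (\<lambda>x. f n (Bot x))"
    by (rule eventually_half[OF assms(1) assms(1)]) (use assms(2) in \<open>simp add: admissible_def\<close>)
  moreover have "\<forall>\<^sub>F n in F. half t (\<lambda>x. - f n (Bot x)) (\<lambda>x. - f n (Top x))"
    by (rule eventually_half[OF tendsto_minus[OF assms(1)] tendsto_minus[OF assms(1)]])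
      (use assms(2) in \<open>simp add: admissible_def\<close>)
  ultimately show ?thesis by (simp add: admissible_def eventually_conj_iff)
qed

text \<open>Strictness makes the condition open. Pairs with equal values are exempt, since
  \<open>p\<close> is linked to itself at distance 0.\<close>

definition lipschitz :: "(vertex \<Rightarrow> real) \<Rightarrow> (vertex \<Rightarrow> real \<times> real) \<Rightarrow> bool" where
  "lipschitz \<psi> g \<longleftrightarrow>
    (\<forall>p q. linked p q \<longrightarrow> \<psi> p \<noteq> \<psi> q \<longrightarrow> \<bar>\<psi> p - \<psi> q\<bar> < dist (g p) (g q))"

lemma eventually_lipschitz:
  assumes "\<And>p. ((\<lambda>n. f n p) \<longlongrightarrow> g p) F" "lipschitz \<psi> g"
  shows "\<forall>\<^sub>F n in F. lipschitz \<psi> (f n)"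
proof -
  have *: "\<forall>\<^sub>F n in F. linked p q \<longrightarrow> \<psi> p \<noteq> \<psi> q \<longrightarrow> \<bar>\<psi> p - \<psi> q\<bar> < dist (f n p) (f n q)" for p q
  proof (cases "linked p q \<and> \<psi> p \<noteq> \<psi> q")
    case True
    then have "\<bar>\<psi> p - \<psi> q\<bar> < dist (g p) (g q)" using assms(2) by (auto simp: lipschitz_def)
    from order_tendstoD(1)[OF tendsto_dist[OF assms(1) assms(1)] this]
    show ?thesis by (rule eventually_mono) blast
  qed auto
  have "\<forall>\<^sub>F n in F. \<forall>p\<in>UNIV. \<forall>q\<in>UNIV. linked p q \<longrightarrow> \<psi> p \<noteq> \<psi> q \<longrightarrow>
      \<bar>\<psi> p - \<psi> q\<bar> < dist (f n p) (f n q)"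
    by (intro eventually_ball_finite finite_vertex ballI *)
  then show ?thesis by (simp only: lipschitz_def ball_UNIV)
qed

section \<open>Choice of the point set and the final estimate\<close>

theorem mainTheorem16:
  fixes k :: nat and \<epsilon> :: real
  assumes "k \<ge> 1" and "\<epsilon> > 0"
  shows "\<exists>P u w. finite P \<and> general_position (4 * k + 4) P \<and> u \<in> P \<and> w \<in> P \<and> u \<noteq> w \<and>
           (\<exists>ps. theta_path (4 * k + 4) P ps u w) \<and>
           (\<forall>ps. theta_path (4 * k + 4) P ps u w \<longrightarrow>
              path_length ps \<ge>
                (1 + 2 * tan (cone_angle (4 * k + 4) / 2)
                   + 2 * (tan (cone_angle (4 * k + 4) / 2))\<^sup>2 - \<epsilon>) * dist u w)"
proof -
  define m where "m = 4 * k + 4"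
  define t where "t = tan (cone_angle m / 2)"
  have "4 * k + 4 = 4 * (k + 1)" by simp
  then interpret quadrant_cones m t
    using assms(1) by unfold_locales (auto simp: m_def t_def)
  define s where "s = sqrt (1 + t\<^sup>2)"
  define R where "R = level t W"
  \<comment> \<open>Shrinking the potential by the factor 1 - \<zeta> makes its edge bounds strict,
    and since \<zeta> R < \<epsilon> it costs less than \<epsilon> in the ratio.\<close>
  define \<zeta> where "\<zeta> = \<epsilon> / (R + \<epsilon>)"
  define \<psi> where "\<psi> p = (1 - \<zeta>) * (s * potential t p)" for p
  define strict where "strict g \<longleftrightarrow> lipschitz \<psi> g \<and>
    (R - \<epsilon>) * dist (g (Bot W)) (g (Top W)) < \<psi> (Top W) - \<psi> (Bot W)" for g
  have "0 < t\<^sup>2" using t_pos by simp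
  then have t: "0 < t" "t < 1/2" using t_pos t_small by linarith+
  have s: "0 < s" by (simp add: s_def one_plus_t_sq_pos)
  have R: "0 < R" using t by (simp add: R_def add_pos_nonneg)
  have z: "0 < \<zeta>" "\<zeta> < 1" "\<zeta> * R < \<epsilon>"
    using R assms(2) by (auto simp: \<zeta>_def divide_simps algebra_simps)
  have "strict (conf t 0)"
    unfolding strict_def lipschitz_def
  proof (intro conjI allI impI)
    fix p q assume pq: "linked p q" "\<psi> p \<noteq> \<psi> q"
    have "\<bar>\<psi> p - \<psi> q\<bar> = (1 - \<zeta>) * (s * \<bar>potential t p - potential t q\<bar>)"
      using s z by (simp add: \<psi>_def abs_mult flip: right_diff_distrib)
    also have "\<dots> < 1 * (s * \<bar>potential t p - potential t q\<bar>)"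
      using s z pq by (intro mult_strict_right_mono) (auto simp: \<psi>_def)
    also have "\<dots> \<le> dist (conf t 0 p) (conf t 0 q)"
      using potential_le_dist[OF t pq(1)] by (simp add: s_def)
    finally show "\<bar>\<psi> p - \<psi> q\<bar> < dist (conf t 0 p) (conf t 0 q)" .
  next
    have "dist (conf t 0 (Bot W)) (conf t 0 (Top W)) = s"
      by (simp add: dist_prod_def dist_real_def s_def add.commute)
    moreover have "\<psi> (Top W) - \<psi> (Bot W) = (1 - \<zeta>) * (s * R)"
      by (simp add: \<psi>_def R_def)
    moreover have "(R - \<epsilon>) * s < (R - \<zeta> * R) * s"
      using s z by (intro mult_strict_right_mono) auto
    ultimately show "(R - \<epsilon>) * dist (conf t 0 (Bot W)) (conf t 0 (Top W)) < \<psi> (Top W) - \<psi> (Bot W)"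
      by (simp add: algebra_simps)
  qed
  \<comment> \<open>The filter is arbitrary because the fact serves both limits, \<open>e\<close> to
    0 from the right and \<open>n\<close> to infinity.\<close>
  have eventually_strict: "\<forall>\<^sub>F n in F. strict (f n)"
    if lim: "\<And>p. ((\<lambda>n. f n p) \<longlongrightarrow> g p) F" and g: "strict g" for f g and F :: "'z filter"
  proof -
    have "((\<lambda>n. (R - \<epsilon>) * dist (f n (Bot W)) (f n (Top W))) \<longlongrightarrow> (R - \<epsilon>) * dist (g (Bot W)) (g (Top W))) F"
      by (intro tendsto_intros lim)
    from eventually_less_tendsto[OF this tendsto_const] g eventually_lipschitz[OF lim]
    show ?thesis by (simp add: strict_def eventually_conj_iff)
  qed
  have "\<forall>\<^sub>F e in at_right 0. strict (conf t e)"
    by (rule eventually_strict[OF tendsto_conf \<open>strict (conf t 0)\<close>])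
  moreover have "\<forall>\<^sub>F e in at_right 0. e \<in> {0<..<t ^ 3 / 20}"
    by (rule eventually_at_right_real) (use t in simp)
  ultimately have "\<forall>\<^sub>F e in at_right 0. strict (conf t e) \<and> e \<in> {0<..<t ^ 3 / 20}"
    by (rule eventually_conj)
  then obtain e where "strict (conf t e)" "0 < e" "e < t ^ 3 / 20"
    using eventually_happens'[OF trivial_limit_at_right_real] by auto
  then have e: "strict (conf t e)" "admissible t (conf t e)"
    using admissible_conf[OF t] by blast+
  obtain G where lim: "\<And>p. (\<lambda>n. G n p) \<longlonglongrightarrow> conf t e p"
    and G: "\<And>n. inj (G n)" "\<And>n. general_position m (range (G n))"
    using general_position_sequence[OF finite_vertex] by metis
  \<comment> \<open>The second move: both conditions are open, so they survive the passage to
    general position.\<close>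
  have "\<forall>\<^sub>F n in sequentially. strict (G n) \<and> admissible t (G n)"
    using eventually_conj[OF eventually_strict[OF lim e(1)] eventually_admissible[OF lim e(2)]] .
  then obtain n where n: "strict (G n)" "admissible t (G n)"
    using eventually_happens'[OF sequentially_bot] by blast
  define g where "g = G n"
  have g: "inj g" "general_position m (range g)" "strict g" "admissible t g"
    using G n by (simp_all add: g_def)
  let ?u = "g (Bot W)" and ?w = "g (Top W)"
  have length: "(R - \<epsilon>) * dist ?u ?w \<le> path_length ps" if ps: "theta_path m (range g) ps ?u ?w" for ps
  proof -
    \<comment> \<open>The potential lives on labels; the injective \<open>g\<close> carries it over
      to points.\<close>
    have "\<psi> (inv g ?w) - \<psi> (inv g ?u) \<le> path_length ps"
    proof (rule path_length_ge_potential[OF _ ps])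
      fix x y assume xy: "theta_edge m (range g) x y"
      then obtain p q where pq: "x = g p" "y = g q" unfolding theta_edge_def by blast
      have "linked p q"
        using linked_if_adjacent[OF g(4)] xy pq by (simp add: adjacent_def)
      then have "\<bar>\<psi> p - \<psi> q\<bar> \<le> dist (g p) (g q)"
        using g(3) unfolding strict_def lipschitz_def by (cases "\<psi> p = \<psi> q") (auto intro: less_imp_le)
      then show "\<bar>\<psi> (inv g x) - \<psi> (inv g y)\<bar> \<le> dist x y"
        by (simp add: pq g(1))
    qed
    then show ?thesis using g(1,3) by (simp add: strict_def)
  qed
  have ratio: "R - \<epsilon> = 1 + 2 * tan (cone_angle m / 2) + 2 * (tan (cone_angle m / 2))\<^sup>2 - \<epsilon>"
    by (simp add: R_def t_def)
  have "finite (range g)" using finite_vertex by simp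
  moreover have "?u \<noteq> ?w" using g(1) by (simp add: inj_eq)
  moreover have "\<exists>ps. theta_path m (range g) ps ?u ?w"
    using theta_path_if_admissible[OF g(4)] by blast
  ultimately show ?thesis
    unfolding m_def[symmetric] ratio[symmetric] using g(2) length by blast
qed

end
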